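(* Let $W$ be a positive locally integrable function on $\mathbb{R}$. (1) If $\liminf_{r\to0}\ \ln(r)\int_0^rsW(s)\,ds>-\infty$, then for every $R>0$ there exists $\alpha:=\alpha(R)>0$ such that the scaled function $W_\alpha(x):=\alpha^2W(\alpha x)$ is a Bessel potential on $(0,R)$. (2) If $\lim_{r\to0}\ \ln(r)\int_0^rsW(s)\,ds=-\infty$, then there are no $\alpha,c>0$ for which $W_{\alpha,c}=cW(\alpha|x|)$ is a Bessel potential on $(0,R)$.
   Context: Limits are as $r\to0^+$, and $R>0$. A non-negative real-valued $C^1$ function $W$ is a Bessel potential on $(0,R)$ if there exists $c>0$ such that the equation $y''+\frac1r y'+cW(r)y=0$ has a positive solution on $(0,R)$.
   Formalization: Since W is only locally integrable, W_α need not be C^1: part (1) gives a positive solution with locally absolutely continuous derivative satisfying the equation almost everywhere, and a Bessel potential in the defined C^1 sense whenever W_α is C^1 on (0,R). *)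

theory Defs
  imports "HOL-Analysis.Analysis"
begin

definition bessel_classical_solution ::
    "(real \<Rightarrow> real) \<Rightarrow> real \<Rightarrow> real \<Rightarrow> (real \<Rightarrow> real) \<Rightarrow> bool" where
  "bessel_classical_solution W c R y \<longleftrightarrow>
     (\<exists>y1 y2. \<forall>r\<in>{0<..<R}.
        (y has_real_derivative y1 r) (at r) \<and>
        (y1 has_real_derivative y2 r) (at r) \<and>
        y2 r + y1 r / r + c * W r * y r = 0)"

definition bessel_potential :: "(real \<Rightarrow> real) \<Rightarrow> real \<Rightarrow> bool" where
  "bessel_potential W R \<longleftrightarrow>
     W C1_differentiable_on {0<..<R} \<and> (\<forall>r\<in>{0<..<R}. 0 \<le> W r) \<and>
     (\<exists>c>0. \<exists>y. (\<forall>r\<in>{0<..<R}. 0 < y r) \<and> bessel_classical_solution W c R y)"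

text \<open>
  For a coefficient that is only locally integrable, the equation is understood in the sense of
  Caratheodory: the solution is differentiable, its derivative \<open>y1\<close> is locally absolutely
  continuous (that is, the indefinite integral of a locally integrable \<open>y2\<close>, which is then the
  second derivative almost everywhere), and the equation holds almost everywhere.
\<close>

definition bessel_caratheodory_solution ::
    "(real \<Rightarrow> real) \<Rightarrow> real \<Rightarrow> real \<Rightarrow> (real \<Rightarrow> real) \<Rightarrow> bool" where
  "bessel_caratheodory_solution W c R y \<longleftrightarrow>
     (\<exists>y1 y2.
        (\<forall>r\<in>{0<..<R}. (y has_real_derivative y1 r) (at r)) \<and>
        (\<forall>a b. 0 < a \<and> a \<le> b \<and> b < R \<longrightarrow>
           y2 absolutely_integrable_on {a..b} \<and> integral {a..b} y2 = y1 b - y1 a) \<and>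
        (AE r in lebesgue. r \<in> {0<..<R} \<longrightarrow> y2 r + y1 r / r + c * W r * y r = 0))"

definition bessel_potential_caratheodory :: "(real \<Rightarrow> real) \<Rightarrow> real \<Rightarrow> bool" where
  "bessel_potential_caratheodory W R \<longleftrightarrow>
     (\<forall>r\<in>{0<..<R}. 0 \<le> W r) \<and>
     (\<exists>c>0. \<exists>y. (\<forall>r\<in>{0<..<R}. 0 < y r) \<and> bessel_caratheodory_solution W c R y)"

lemma bessel_caratheodory_solution_iff_classical:
  assumes W: "continuous_on {0<..<R} W"
  shows "bessel_caratheodory_solution W c R y \<longleftrightarrow> bessel_classical_solution W c R y"
proof
  assume "bessel_classical_solution W c R y"
  then obtain y1 y2 where
    y: "\<And>r. r \<in> {0<..<R} \<Longrightarrow> (y has_real_derivative y1 r) (at r)" and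
    y1: "\<And>r. r \<in> {0<..<R} \<Longrightarrow> (y1 has_real_derivative y2 r) (at r)" and
    eq: "\<And>r. r \<in> {0<..<R} \<Longrightarrow> y2 r + y1 r / r + c * W r * y r = 0"
    unfolding bessel_classical_solution_def by blast
  have cont: "continuous_on {0<..<R} y" "continuous_on {0<..<R} y1"
    by (meson continuous_at_imp_continuous_on DERIV_isCont y y1)+
  have "continuous_on {0<..<R} (\<lambda>r. - y1 r / r - c * W r * y r)"
    by (intro continuous_intros cont W) auto
  moreover have "y2 r = - y1 r / r - c * W r * y r" if "r \<in> {0<..<R}" for r
    using eq[OF that] by (simp add: algebra_simps)
  ultimately have cy2: "continuous_on {0<..<R} y2"
    by (metis (no_types, lifting) continuous_on_cong)
  have "y2 absolutely_integrable_on {a..b} \<and> integral {a..b} y2 = y1 b - y1 a"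
    if ab: "0 < a \<and> a \<le> b \<and> b < R" for a b
  proof
    have sub: "{a..b} \<subseteq> {0<..<R}" using ab by auto
    show "y2 absolutely_integrable_on {a..b}"
      using continuous_on_subset[OF cy2 sub] by (rule absolutely_integrable_continuous_real)
    have "(y2 has_integral y1 b - y1 a) {a..b}"
      using ab sub y1
      by (intro fundamental_theorem_of_calculus)
        (auto simp: has_real_derivative_iff_has_vector_derivative[symmetric]
          intro: has_field_derivative_at_within)
    then show "integral {a..b} y2 = y1 b - y1 a" by (rule integral_unique)
  qed
  then show "bessel_caratheodory_solution W c R y"
    unfolding bessel_caratheodory_solution_def using y eq
    by (intro exI[of _ y1] exI[of _ y2]) auto
next
  assume "bessel_caratheodory_solution W c R y"
  then obtain y1 y2 where
    y: "\<And>r. r \<in> {0<..<R} \<Longrightarrow> (y has_real_derivative y1 r) (at r)" and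
    int: "\<And>a b. 0 < a \<Longrightarrow> a \<le> b \<Longrightarrow> b < R \<Longrightarrow> y2 absolutely_integrable_on {a..b}" and
    ftc: "\<And>a b. 0 < a \<Longrightarrow> a \<le> b \<Longrightarrow> b < R \<Longrightarrow> integral {a..b} y2 = y1 b - y1 a" and
    eq: "AE r in lebesgue. r \<in> {0<..<R} \<longrightarrow> y2 r + y1 r / r + c * W r * y r = 0"
    unfolding bessel_caratheodory_solution_def by blast
  define g where "g = (\<lambda>r. - y1 r / r - c * W r * y r)"
  have cont_y: "continuous_on {0<..<R} y"
    by (meson continuous_at_imp_continuous_on DERIV_isCont y)
  have cont_y1': "continuous_on {a..b} y1" if "0 < a" "a \<le> b" "b < R" for a b
  proof -
    have "continuous_on {a..b} (\<lambda>x. y1 a + integral {a..x} y2)"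
      using int[OF that]
      by (intro continuous_intros indefinite_integral_continuous_1)
        (auto simp: absolutely_integrable_on_def)
    moreover have "y1 a + integral {a..x} y2 = y1 x" if "x \<in> {a..b}" for x
      using ftc[of a x] that \<open>0 < a\<close> \<open>b < R\<close> by auto
    ultimately show ?thesis by (rule continuous_on_eq)
  qed
  have cont_y1: "continuous_on {0<..<R} y1"
  proof (intro continuous_at_imp_continuous_on ballI)
    fix r assume r: "r \<in> {0<..<R}"
    then have "continuous_on {r/2..(r+R)/2} y1" by (intro cont_y1') auto
    moreover have "r \<in> interior {r/2..(r+R)/2}" using r by auto
    ultimately show "isCont y1 r" by (rule continuous_on_interior)
  qed
  have cont_g: "continuous_on {0<..<R} g"
    unfolding g_def by (intro continuous_intros cont_y cont_y1 W) auto
  obtain N where neg: "negligible N" and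
    N: "{r. \<not> (r \<in> {0<..<R} \<longrightarrow> y2 r + y1 r / r + c * W r * y r = 0)} \<subseteq> N"
    using iffD1[OF eventually_ae_filter_negligible eq] by (elim exE conjE)
  have ae_eq: "y2 r + y1 r / r + c * W r * y r = 0" if "r \<in> {0<..<R}" "r \<notin> N" for r
    using subsetD[OF N, of r] that by auto
  have y1': "(y1 has_real_derivative g r) (at r)" if r: "r \<in> {0<..<R}" for r
  proof -
    define a b where "a = r/2" and "b = (r+R)/2"
    have ab: "0 < a" "a < r" "r < b" "b < R" using r by (auto simp: a_def b_def)
    have sub: "{a..b} \<subseteq> {0<..<R}" using ab by auto
    have "((\<lambda>x. integral {a..x} g) has_real_derivative g r) (at r within {a..b})"
      using continuous_on_subset[OF cont_g sub] ab
      by (intro integral_has_real_derivative) auto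
    moreover have "at r within {a..b} = at r"
      using ab by (intro at_within_interior) auto
    ultimately have der: "((\<lambda>x. y1 a + integral {a..x} g) has_real_derivative g r) (at r)"
      by (auto intro!: derivative_eq_intros)
    have val: "y1 a + integral {a..x} g = y1 x" if "x \<in> {a<..<b}" for x
    proof -
      have "integral {a..x} g = integral {a..x} y2"
      proof (rule integral_spike[OF neg])
        fix s assume "s \<in> {a..x} - N"
        then have "y2 s + y1 s / s + c * W s * y s = 0"
          using that sub ab by (intro ae_eq) auto
        then show "y2 s = g s" by (simp add: g_def algebra_simps)
      qed
      then show ?thesis using ftc[of a x] that ab by auto
    qed
    show ?thesis
      by (rule has_field_derivative_transform_within_open[OF der _ _ val, of "{a<..<b}"])
        (use ab in auto)
  qed
  show "bessel_classical_solution W c R y"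
    unfolding bessel_classical_solution_def using y y1'
    by (intro exI[of _ y1] exI[of _ g]) (auto simp: g_def)
qed

lemma bessel_potential_iff_caratheodory:
  assumes "W C1_differentiable_on {0<..<R}"
  shows "bessel_potential W R \<longleftrightarrow> bessel_potential_caratheodory W R"
  using assms
    bessel_caratheodory_solution_iff_classical[OF C1_differentiable_imp_continuous_on[OF assms]]
  by (simp add: bessel_potential_def bessel_potential_caratheodory_def)

text \<open>
  The moment below is taken in the extended sense, so that a divergent integral is infinite;
  with a Bochner or Henstock-Kurzweil integral it would be \<open>0\<close>.
\<close>

definition log_moment :: "(real \<Rightarrow> real) \<Rightarrow> real \<Rightarrow> ereal" where
  "log_moment W r = ereal (ln r) * enn2ereal (\<integral>\<^sup>+ s\<in>{0<..<r}. ennreal (s * W s) \<partial>lebesgue)"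

end

theory Submission
  imports Defs
begin

text \<open>
  In the variable \<open>ln r\<close> a positive solution \<open>y\<close> is a positive concave function on a half-line,
  so \<open>r y'\<close> is nonincreasing and nonpositive. Integrating \<open>(r y')' = - c r W y\<close> bounds \<open>- r y'\<close>
  below by \<open>c y(r)\<close> times the moment of \<open>W\<close> on \<open>(0, r)\<close>, while concavity bounds it above by
  \<open>y(r) / ln (r0 / r)\<close>; hence the moment is \<open>O(1 / |ln r|)\<close>, which is part (2).

  For part (1), \<open>u = - r y' / y\<close> satisfies the Riccati equation \<open>u(r) = \<integral>\<^sub>0\<^sup>r (c s W + u\<^sup>2 / s) ds\<close>.
  Its right-hand side is monotone in \<open>u\<close>, and for small \<open>c\<close> the function \<open>1 / (2 ln (\<rho> / r))\<close> is a
  supersolution, so that the least fixed point in the lattice of extended nonnegative functions is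
  finite; then \<open>y = exp (- \<integral> u / r)\<close>.
\<close>

section \<open>Products with an absolutely continuous factor\<close>

lemma absolutely_integrable_continuous_mult:
  fixes f G :: "real \<Rightarrow> real"
  assumes f: "f absolutely_integrable_on {a..b}" and G: "continuous_on {a..b} G"
  shows "(\<lambda>x. G x * f x) absolutely_integrable_on {a..b}"
proof (rule absolutely_integrable_bounded_measurable_product_real[OF _ _ _ f])
  show "G \<in> borel_measurable (lebesgue_on {a..b})"
    using G by (intro continuous_imp_measurable_on_sets_lebesgue) auto
  show "bounded (G ` {a..b})"
    using G by (intro compact_imp_bounded compact_continuous_image) auto
qed auto

text \<open>
  \<open>F\<close> is only absolutely continuous. On an interval of length below a modulus of continuity of
  \<open>F\<close> and \<open>G\<close> the identity holds up to \<open>\<epsilon> \<integral> (|f| + |g|)\<close>, and these errors add up.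
\<close>

lemma integral_product_rule:
  fixes f g F G :: "real \<Rightarrow> real"
  assumes ab: "a \<le> b"
    and f: "f absolutely_integrable_on {a..b}"
    and F: "\<And>x. x \<in> {a..b} \<Longrightarrow> F x - F a = integral {a..x} f"
    and G: "\<And>x. x \<in> {a..b} \<Longrightarrow> (G has_real_derivative g x) (at x within {a..b})"
    and g: "continuous_on {a..b} g"
  shows "(\<lambda>x. f x * G x + F x * g x) absolutely_integrable_on {a..b}" (is ?I)
    and "integral {a..b} (\<lambda>x. f x * G x + F x * g x) = F b * G b - F a * G a"
proof -
  define h where "h = (\<lambda>x. f x * G x + F x * g x)"
  define k where "k = (\<lambda>x. \<bar>f x\<bar> + \<bar>g x\<bar>)"
  have sub: "\<phi> integrable_on {x..y}" if "\<phi> integrable_on {a..b}" "a \<le> x" "y \<le> b"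
    for \<phi> :: "real \<Rightarrow> real" and x y
    using that by (intro integrable_on_subinterval[OF that(1)]) auto
  have f': "f integrable_on {a..b}"
    using f by (simp add: absolutely_integrable_on_def)
  have contG: "continuous_on {a..b} G"
    using G by (intro DERIV_continuous_on)
  have "continuous_on {a..b} (\<lambda>x. F a + integral {a..x} f)"
    by (intro continuous_intros indefinite_integral_continuous_1 f')
  moreover have "F a + integral {a..x} f = F x" if "x \<in> {a..b}" for x
    using F[OF that] by linarith
  ultimately have contF: "continuous_on {a..b} F"
    by (rule continuous_on_eq)
  have hI: "h absolutely_integrable_on {a..b}"
    unfolding h_def
    using absolutely_integrable_continuous_mult[OF f contG]
      absolutely_integrable_continuous_real[OF continuous_on_mult[OF contF g]]
    by (intro set_integral_add(1)) (simp_all add: mult.commute)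
  then show ?I by (simp add: h_def)
  have h': "h integrable_on {a..b}"
    using hI by (simp add: absolutely_integrable_on_def)
  have k': "k integrable_on {a..b}"
    unfolding k_def using f integrable_continuous_real[OF continuous_on_rabs[OF g]]
    by (intro integrable_add) (auto simp: absolutely_integrable_on_def)
  have Fint: "integral {x..y} f = F y - F x" if "a \<le> x" "x \<le> y" "y \<le> b" for x y
    using F[of x] F[of y] Henstock_Kurzweil_Integration.integral_combine[of a x y f] that sub[OF f', of a y] by auto
  have Gint: "(g has_integral G y - G x) {x..y}" if "a \<le> x" "x \<le> y" "y \<le> b" for x y
    using that G
    by (intro fundamental_theorem_of_calculus)
      (auto simp: has_real_derivative_iff_has_vector_derivative[symmetric]
        intro: DERIV_subset[where s = "{a..b}"])
  have bound: "\<bar>F b * G b - F a * G a - integral {a..b} h\<bar> \<le> e * integral {a..b} k"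
    if e: "e > 0" for e
  proof -
    obtain d1 where d1: "d1 > 0" "\<And>x y. x \<in> {a..b} \<Longrightarrow> y \<in> {a..b} \<Longrightarrow> dist y x < d1 \<Longrightarrow> dist (G y) (G x) < e"
      using compact_uniformly_continuous[OF contG] e unfolding uniformly_continuous_on_def by force
    obtain d2 where d2: "d2 > 0" "\<And>x y. x \<in> {a..b} \<Longrightarrow> y \<in> {a..b} \<Longrightarrow> dist y x < d2 \<Longrightarrow> dist (F y) (F x) < e"
      using compact_uniformly_continuous[OF contF] e unfolding uniformly_continuous_on_def by force
    \<comment> \<open>\<open>Bolzano\<close> extends an interval property that survives
      concatenation and holds on short intervals around each point. It ranges over all reals, so the
      guards in \<open>P\<close> confine it to \<open>{a..b}\<close>.\<close>
    define P where "P = (\<lambda>x y. a \<le> x \<longrightarrow> x \<le> y \<longrightarrow> y \<le> b \<longrightarrow>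
        \<bar>F y * G y - F x * G x - integral {x..y} h\<bar> \<le> e * integral {x..y} k)"
    have "P a b"
      using ab
    proof (induction rule: Bolzano)
      case (trans x y z)
      show ?case
        unfolding P_def
      proof (intro impI)
        assume xz: "a \<le> x" "x \<le> z" "z \<le> b"
        have "integral {x..y} h + integral {y..z} h = integral {x..z} h"
             "integral {x..y} k + integral {y..z} k = integral {x..z} k"
          using xz trans by (auto intro!: Henstock_Kurzweil_Integration.integral_combine sub h' k')
        moreover have "\<bar>F y * G y - F x * G x - integral {x..y} h\<bar> \<le> e * integral {x..y} k"
            "\<bar>F z * G z - F y * G y - integral {y..z} h\<bar> \<le> e * integral {y..z} k"
          using trans xz unfolding P_def by auto
        ultimately show "\<bar>F z * G z - F x * G x - integral {x..z} h\<bar> \<le> e * integral {x..z} k"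
          by (smt (verit) distrib_left)
      qed
    next
      case (local x0)
      show ?case
      proof (intro exI[of _ "min d1 d2"] conjI allI impI)
        show "min d1 d2 > 0" using d1 d2 by auto
        fix x y assume xy0: "x \<le> x0 \<and> x0 \<le> y \<and> y - x < min d1 d2"
        show "P x y"
          unfolding P_def
        proof (intro impI)
          assume xy: "a \<le> x" "x \<le> y" "y \<le> b"
          \<comment> \<open>Freezing \<open>G\<close> at the left endpoint and \<open>F\<close> at
            the right one gives an integrand whose integral telescopes exactly to
            \<open>F y * G y - F x * G x\<close>. What remains is the error of freezing, at most
            \<open>e * k s\<close> pointwise.\<close>
          have "((\<lambda>s. f s * G x + g s * F y) has_integral (F y - F x) * G x + (G y - G x) * F y) {x..y}"
            using Fint[OF xy] sub[OF f', of x y] xy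
            by (intro has_integral_add has_integral_mult_left Gint)
              (auto simp: has_integral_iff)
          then have 1: "((\<lambda>s. (f s * G x + g s * F y) - h s) has_integral
              (F y - F x) * G x + (G y - G x) * F y - integral {x..y} h) {x..y}"
            using sub[OF h', of x y] xy by (intro has_integral_diff integrable_integral)
          have le: "\<bar>(f s * G x + g s * F y) - h s\<bar> \<le> e * k s" if s: "s \<in> {x..y}" for s
          proof -
            have "\<bar>G x - G s\<bar> \<le> e"
              using d1(2)[of s x] s xy xy0 by (auto simp: dist_real_def)
            moreover have "\<bar>F y - F s\<bar> \<le> e"
              using d2(2)[of s y] s xy xy0 by (auto simp: dist_real_def)
            ultimately have "\<bar>f s\<bar> * \<bar>G x - G s\<bar> + \<bar>g s\<bar> * \<bar>F y - F s\<bar> \<le> \<bar>f s\<bar> * e + \<bar>g s\<bar> * e"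
              by (intro add_mono mult_left_mono) auto
            moreover have "(f s * G x + g s * F y) - h s = f s * (G x - G s) + g s * (F y - F s)"
              by (simp add: h_def algebra_simps)
            moreover have "\<bar>f s * (G x - G s) + g s * (F y - F s)\<bar> \<le> \<bar>f s\<bar> * \<bar>G x - G s\<bar> + \<bar>g s\<bar> * \<bar>F y - F s\<bar>"
              by (metis abs_triangle_ineq abs_mult)
            ultimately show ?thesis by (simp add: k_def algebra_simps)
          qed
          have "norm (integral {x..y} (\<lambda>s. (f s * G x + g s * F y) - h s)) \<le> integral {x..y} (\<lambda>s. e * k s)"
            using 1 le integrable_cmul[OF sub[OF k', of x y], of e] xy
            by (intro integral_norm_bound_integral) (auto simp: has_integral_iff)
          then show "\<bar>F y * G y - F x * G x - integral {x..y} h\<bar> \<le> e * integral {x..y} k"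
            using integral_unique[OF 1] by (simp add: algebra_simps)
        qed
      qed
    qed
    then show ?thesis using ab by (simp add: P_def)
  qed
  have "F b * G b - F a * G a - integral {a..b} h = 0"
  proof (rule ccontr)
    assume n: "F b * G b - F a * G a - integral {a..b} h \<noteq> 0"
    define D where "D = \<bar>F b * G b - F a * G a - integral {a..b} h\<bar>"
    have D: "D > 0" using n by (simp add: D_def)
    have K: "0 \<le> integral {a..b} k" by (intro integral_nonneg k') (simp add: k_def)
    \<comment> \<open>This choice of \<open>e\<close> makes the error at most \<open>D / 2\<close>;
      the \<open>+ 1\<close> covers the case that the integral of \<open>k\<close> vanishes.\<close>
    have "D \<le> D / (2 * (integral {a..b} k + 1)) * integral {a..b} k"
      unfolding D_def[symmetric] using bound[of "D / (2 * (integral {a..b} k + 1))"] D K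
      by (simp add: D_def)
    also have "\<dots> \<le> D / 2"
      using D K by (simp add: field_simps)
    finally show False using D by simp
  qed
  then show "integral {a..b} (\<lambda>x. f x * G x + F x * g x) = F b * G b - F a * G a"
    by (simp add: h_def)
qed

section \<open>Extended integrals over \<open>{0<..<r}\<close>: exhaustion, measurability and
  scaling\<close>

lemma nn_integral_eq_integral:
  fixes f :: "real \<Rightarrow> real"
  assumes "f integrable_on A" "\<And>x. x \<in> A \<Longrightarrow> 0 \<le> f x"
  shows "(\<integral>\<^sup>+x\<in>A. ennreal (f x) \<partial>lebesgue) = ennreal (integral A f)"
  using nn_integral_has_integral_lebesgue'[OF assms(2) integrable_integral[OF assms(1)]]
  by (simp add: nn_integral_completion)

text \<open>Monotone convergence along compact intervals that exhaust \<open>{0<..<r}\<close>.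
  Integrability is known only away from 0, and uniform bounds there carry over to the extended
  integral.\<close>

lemma nn_integral_Ioo_le:
  fixes f :: "real \<Rightarrow> real"
  assumes int: "\<And>a. 0 < a \<Longrightarrow> a < r \<Longrightarrow> f integrable_on {a..r}"
    and nonneg: "\<And>x. 0 < x \<Longrightarrow> x \<le> r \<Longrightarrow> 0 \<le> f x"
    and bound: "\<And>a. 0 < a \<Longrightarrow> a < r \<Longrightarrow> integral {a..r} f \<le> B"
    and r: "0 < r"
  shows "(\<integral>\<^sup>+x\<in>{0<..<r}. ennreal (f x) \<partial>lebesgue) \<le> ennreal B"
proof -
  \<comment> \<open>The shift by 2 keeps the left endpoint strictly below \<open>r\<close> already
    for \<open>n = 0\<close>.\<close>
  define A where "A = (\<lambda>n::nat. {r / (real n + 2)..r})"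
  have A: "0 < r / (real n + 2)" "r / (real n + 2) < r" for n
    using r by (auto simp: field_simps add_pos_nonneg)
  have cover: "\<exists>n. x \<in> A n" if "x \<in> {0<..<r}" for x
  proof -
    obtain n where "r / x < real n" using reals_Archimedean2 by blast
    then have "r / (real n + 2) \<le> x" using that r by (simp add: field_simps)
    then show ?thesis using that by (auto simp: A_def)
  qed
  have meas: "(\<lambda>x. ennreal (f x) * indicator (A n) x) \<in> borel_measurable lebesgue" for n
  proof -
    have "f absolutely_integrable_on A n"
      using A[of n] int nonneg r unfolding A_def
      by (intro nonnegative_absolutely_integrable_1) (auto intro: less_le_trans[OF A(1)])
    then have "(\<lambda>x. indicator (A n) x * f x) \<in> borel_measurable lebesgue"
      unfolding set_integrable_def by (auto dest: borel_measurable_integrable)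
    then have "(\<lambda>x. ennreal (indicator (A n) x * f x)) \<in> borel_measurable lebesgue"
      by measurable
    moreover have "ennreal (indicator (A n) x * f x) = ennreal (f x) * indicator (A n) x" for x
      by (auto simp: indicator_def)
    ultimately show ?thesis by simp
  qed
  have inc: "incseq (\<lambda>n x. ennreal (f x) * indicator (A n) x)"
  proof (intro incseq_SucI le_funI mult_left_mono)
    fix n x
    have "r / (real (Suc n) + 2) \<le> r / (real n + 2)" using r by (intro divide_left_mono) auto
    then show "(indicator (A n) x :: ennreal) \<le> indicator (A (Suc n)) x"
      by (auto simp: A_def split: split_indicator)
  qed auto
  have "(\<integral>\<^sup>+x\<in>{0<..<r}. ennreal (f x) \<partial>lebesgue) \<le>
      (\<integral>\<^sup>+x. (SUP n. ennreal (f x) * indicator (A n) x) \<partial>lebesgue)"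
  proof (intro nn_integral_mono)
    fix x
    show "ennreal (f x) * indicator {0<..<r} x \<le> (SUP n. ennreal (f x) * indicator (A n) x)"
    proof (cases "x \<in> {0<..<r}")
      case True
      then obtain n where "x \<in> A n" using cover by blast
      then show ?thesis using True by (intro SUP_upper2[of n]) auto
    qed auto
  qed
  also have "\<dots> = (SUP n. (\<integral>\<^sup>+x\<in>A n. ennreal (f x) \<partial>lebesgue))"
    using inc meas by (intro nn_integral_monotone_convergence_SUP) auto
  also have "\<dots> \<le> ennreal B"
  proof (intro SUP_least)
    fix n
    have "(\<integral>\<^sup>+x\<in>A n. ennreal (f x) \<partial>lebesgue) = ennreal (integral (A n) f)"
      using A[of n] int nonneg r unfolding A_def
      by (intro nn_integral_eq_integral) (auto intro: less_le_trans[OF A(1)])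
    then show "(\<integral>\<^sup>+x\<in>A n. ennreal (f x) \<partial>lebesgue) \<le> ennreal B"
      using bound[of "r / (real n + 2)"] A[of n] by (auto simp: A_def intro!: ennreal_leI)
  qed
  finally show ?thesis .
qed

text \<open>The function is the pointwise limit of its restrictions to the compact intervals
  \<open>{e n..R - e n}\<close>. Those that are empty contribute the zero function.\<close>

lemma borel_measurable_locally_integrable:
  fixes f :: "real \<Rightarrow> real"
  assumes f: "\<And>a b. 0 < a \<Longrightarrow> a \<le> b \<Longrightarrow> b < R \<Longrightarrow> f absolutely_integrable_on {a..b}"
  shows "(\<lambda>x. indicator {0<..<R} x * f x) \<in> borel_measurable lebesgue"
proof (rule borel_measurable_LIMSEQ_real)
  define e where "e = (\<lambda>n::nat. 1 / (real n + 1))"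
  have e0: "e n > 0" for n by (simp add: e_def add_pos_nonneg)
  have elim: "e \<longlonglongrightarrow> 0"
    unfolding e_def using LIMSEQ_inverse_real_of_nat by (simp add: inverse_eq_divide add.commute)
  show "(\<lambda>n. indicator {e n..R - e n} x * f x) \<longlonglongrightarrow> indicator {0<..<R} x * f x" for x
  proof (cases "x \<in> {0<..<R}")
    case True
    then have "eventually (\<lambda>n. e n < min x (R - x)) sequentially"
      using order_tendstoD(2)[OF elim, of "min x (R - x)"] by auto
    then have "eventually (\<lambda>n. indicator {e n..R - e n} x * f x = indicator {0<..<R} x * f x) sequentially"
      by eventually_elim (use True in auto)
    then show ?thesis by (rule tendsto_eventually)
  next
    case False
    then have "x \<notin> {e n..R - e n}" for n using e0[of n] by auto
    then show ?thesis using False by simp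
  qed
  show "(\<lambda>x. indicator {e n..R - e n} x * f x) \<in> borel_measurable lebesgue" for n
  proof (cases "e n \<le> R - e n")
    case True
    then have "f absolutely_integrable_on {e n..R - e n}"
      using e0[of n] by (intro f) auto
    then show ?thesis
      unfolding set_integrable_def by (auto dest: borel_measurable_integrable)
  qed auto
qed

text \<open>Substituting \<open>\<alpha> * s\<close> in the moment turns \<open>s ds\<close> into
  \<open>\<alpha>\<^sup>2\<close> times itself. The factor \<open>k\<close> stays free because part
  (1) scales by \<open>\<alpha>\<^sup>2\<close>, which cancels, and part (2) by an arbitrary
  constant.\<close>

lemma moment_scaling:
  fixes W :: "real \<Rightarrow> real"
  assumes W: "\<And>a b. 0 < a \<Longrightarrow> a \<le> b \<Longrightarrow> W absolutely_integrable_on {a..b}"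
    and \<alpha>: "0 < \<alpha>" and k: "0 \<le> k"
  shows "ennreal (\<alpha>\<^sup>2) * (\<integral>\<^sup>+s\<in>{0<..<r}. ennreal (s * (k * W (\<alpha> * s))) \<partial>lebesgue) =
    ennreal k * (\<integral>\<^sup>+s\<in>{0<..<\<alpha> * r}. ennreal (s * W s) \<partial>lebesgue)"
proof -
  define f where "f = (\<lambda>s. ennreal (s * W s) * indicator {0<..<\<alpha> * r} s)"
  have "(\<lambda>s. ennreal (s * (indicator {0<..<\<alpha> * r} s * W s))) \<in> borel_measurable lebesgue"
    using measurable_completion[of "\<lambda>x::real. x" lborel borel] W
    by (intro measurable_compose[OF _ measurable_ennreal]
        borel_measurable_times[OF _ borel_measurable_locally_integrable]) auto
  moreover have "ennreal (s * (indicator {0<..<\<alpha> * r} s * W s)) = f s" for s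
    by (auto simp: f_def split: split_indicator)
  ultimately have [measurable]: "f \<in> borel_measurable lebesgue" by simp
  have f': "(\<lambda>s. f (\<alpha> * s)) \<in> borel_measurable lebesgue"
    using measurable_compose[OF lebesgue_measurable_scaling[of \<alpha>], of f] by simp
  have "ennreal k * integral\<^sup>N lebesgue f = ennreal k * (ennreal \<alpha> * (\<integral>\<^sup>+s. f (\<alpha> * s) \<partial>lebesgue))"
    using nn_integral_real_affine_lebesgue[of f \<alpha> 0] \<alpha> by simp
  also have "\<dots> = ennreal \<alpha> * (\<integral>\<^sup>+s. ennreal k * f (\<alpha> * s) \<partial>lebesgue)"
    using f' by (simp add: nn_integral_cmult mult.left_commute)
  also have "(\<integral>\<^sup>+s. ennreal k * f (\<alpha> * s) \<partial>lebesgue) =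
      (\<integral>\<^sup>+s. ennreal \<alpha> * (ennreal (s * (k * W (\<alpha> * s))) * indicator {0<..<r} s) \<partial>lebesgue)"
    using \<alpha> k
    by (intro nn_integral_cong)
      (auto simp: f_def ennreal_mult'[symmetric] mult_ac zero_less_mult_iff split: split_indicator)
  also have "\<dots> = ennreal \<alpha> * (\<integral>\<^sup>+s\<in>{0<..<r}. ennreal (s * (k * W (\<alpha> * s))) \<partial>lebesgue)"
  proof (rule nn_integral_cmult)
    \<comment> \<open>Since \<open>f (\<alpha> * s)\<close> already carries the factor
      \<open>\<alpha> * s\<close>, the integrand is \<open>k / \<alpha>\<close> times it and
      inherits its measurability.\<close>
    have "(\<lambda>s. ennreal (k / \<alpha>) * f (\<alpha> * s)) \<in> borel_measurable lebesgue"
      using f' by measurable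
    moreover have "ennreal (k / \<alpha>) * f (\<alpha> * s) = ennreal (s * (k * W (\<alpha> * s))) * indicator {0<..<r} s" for s
      using \<alpha> k
      by (auto simp: f_def ennreal_mult'[symmetric] mult_ac zero_less_mult_iff split: split_indicator)
    ultimately show "(\<lambda>s. ennreal (s * (k * W (\<alpha> * s))) * indicator {0<..<r} s) \<in> borel_measurable lebesgue"
      by simp
  qed
  finally show ?thesis
    using \<alpha> by (simp add: f_def power2_eq_square ennreal_mult' mult.assoc)
qed

section \<open>From a positive solution to a bound on the moment\<close>

lemma caratheodory_moment_bound:
  assumes V: "bessel_potential_caratheodory V R"
  obtains c where "c > 0"
    "\<And>r r0. 0 < r \<Longrightarrow> r < r0 \<Longrightarrow> r0 < R \<Longrightarrow>
      (\<integral>\<^sup>+s\<in>{0<..<r}. ennreal (s * V s) \<partial>lebesgue) \<le> ennreal (1 / (c * ln (r0 / r)))"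
proof -
  from V obtain c y where c: "c > 0"
    and V0: "\<And>r. r \<in> {0<..<R} \<Longrightarrow> 0 \<le> V r"
    and y0: "\<And>r. r \<in> {0<..<R} \<Longrightarrow> 0 < y r"
    and sol: "bessel_caratheodory_solution V c R y"
    unfolding bessel_potential_caratheodory_def by blast
  from sol obtain y1 y2 where
    y: "\<And>r. r \<in> {0<..<R} \<Longrightarrow> (y has_real_derivative y1 r) (at r)"
    and int: "\<And>a b. 0 < a \<Longrightarrow> a \<le> b \<Longrightarrow> b < R \<Longrightarrow> y2 absolutely_integrable_on {a..b}"
    and ftc: "\<And>a b. 0 < a \<Longrightarrow> a \<le> b \<Longrightarrow> b < R \<Longrightarrow> integral {a..b} y2 = y1 b - y1 a"
    and eq: "AE r in lebesgue. r \<in> {0<..<R} \<longrightarrow> y2 r + y1 r / r + c * V r * y r = 0"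
    unfolding bessel_caratheodory_solution_def by blast
  obtain N where neg: "negligible N" and
    N: "{r. \<not> (r \<in> {0<..<R} \<longrightarrow> y2 r + y1 r / r + c * V r * y r = 0)} \<subseteq> N"
    using iffD1[OF eventually_ae_filter_negligible eq] by (elim exE conjE)
  have ae_eq: "y2 r + y1 r / r + c * V r * y r = 0" if "r \<in> {0<..<R}" "r \<notin> N" for r
    using subsetD[OF N, of r] that by auto
  \<comment> \<open>\<open>w\<close> is the derivative of \<open>y\<close> with respect to
    \<open>ln r\<close>. The equation multiplied by \<open>r\<close> reads
    \<open>w' = - c * h\<close> almost everywhere, so \<open>h \<ge> 0\<close> makes
    \<open>w\<close> nonincreasing, which is concavity in \<open>ln r\<close>.\<close>
  define w where "w = (\<lambda>r. r * y1 r)"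
  define h where "h = (\<lambda>s. s * V s * y s)"
  have h: "(h has_integral (w a - w b) / c) {a..b}" if ab: "0 < a" "a \<le> b" "b < R" for a b
  proof -
    have F: "y1 x - y1 a = integral {a..x} y2" if "x \<in> {a..b}" for x
      using ftc[of a x] that ab by simp
    have *: "(\<lambda>s. y2 s * s + y1 s * 1) absolutely_integrable_on {a..b}"
      "integral {a..b} (\<lambda>s. y2 s * s + y1 s * 1) = y1 b * b - y1 a * a"
      using integral_product_rule[OF ab(2) int[OF ab] F DERIV_ident continuous_on_const] by auto
    have "((\<lambda>s. (y2 s * s + y1 s * 1) * (- 1 / c)) has_integral (y1 b * b - y1 a * a) * (- 1 / c)) {a..b}"
      using * by (intro has_integral_mult_left) (auto simp: has_integral_iff absolutely_integrable_on_def)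
    also have "(y1 b * b - y1 a * a) * (- 1 / c) = (w a - w b) / c"
      using c by (simp add: w_def field_simps)
    finally have "((\<lambda>s. (y2 s * s + y1 s * 1) * (- 1 / c)) has_integral (w a - w b) / c) {a..b}" .
    then show ?thesis
    proof (rule has_integral_spike[OF neg, rotated])
      fix s assume s: "s \<in> {a..b} - N"
      then have "y2 s + y1 s / s + c * V s * y s = 0" using ab by (intro ae_eq) auto
      then have "s * (y2 s + y1 s / s + c * V s * y s) = 0" by simp
      then show "h s = (y2 s * s + y1 s * 1) * (- 1 / c)"
        using s ab c by (simp add: h_def field_simps)
    qed
  qed
  have h0: "0 \<le> h s" if "s \<in> {0<..<R}" for s
    using V0[OF that] y0[OF that] that by (simp add: h_def)
  have w_mono: "w b \<le> w a" if "0 < a" "a \<le> b" "b < R" for a b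
  proof -
    have "0 \<le> (w a - w b) / c"
      using that by (intro has_integral_nonneg[OF h[OF that] h0]) auto
    then show ?thesis using c by (simp add: zero_le_divide_iff)
  qed
  \<comment> \<open>\<open>upper\<close> and \<open>lower\<close> compare \<open>y\<close> with its
    tangent at \<open>r\<close> in the variable \<open>ln\<close>: the difference decreases to the
    right of \<open>r\<close> and increases to the left of it, so \<open>y\<close> stays below the
    tangent.\<close>
  have upper: "y b - w r * ln b \<le> y a - w r * ln a"
    if "0 < r" "r \<le> a" "a \<le> b" "b < R" for r a b
  proof (rule DERIV_nonpos_imp_nonincreasing[OF \<open>a \<le> b\<close>])
    fix x assume x: "a \<le> x" "x \<le> b"
    have "((\<lambda>x. y x - w r * ln x) has_real_derivative (y1 x - w r * (1 / x))) (at x)"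
      using that x by (auto intro!: derivative_eq_intros y)
    moreover have "y1 x - w r * (1 / x) \<le> 0"
      using w_mono[of r x] that x by (simp add: w_def field_simps)
    ultimately show "\<exists>l. ((\<lambda>x. y x - w r * ln x) has_real_derivative l) (at x) \<and> l \<le> 0" by blast
  qed
  have lower: "y a - w r * ln a \<le> y r - w r * ln r"
    if "0 < a" "a \<le> r" "r < R" for r a
  proof (rule DERIV_nonneg_imp_nondecreasing[OF \<open>a \<le> r\<close>])
    fix x assume x: "a \<le> x" "x \<le> r"
    have "((\<lambda>x. y x - w r * ln x) has_real_derivative (y1 x - w r * (1 / x))) (at x)"
      using that x by (auto intro!: derivative_eq_intros y)
    moreover have "0 \<le> y1 x - w r * (1 / x)"
      using w_mono[of x r] that x by (simp add: w_def field_simps)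
    ultimately show "\<exists>l. ((\<lambda>x. y x - w r * ln x) has_real_derivative l) (at x) \<and> 0 \<le> l" by blast
  qed
  have w_le: "w r \<le> 0" if r: "0 < r" "r < R" for r
  proof (rule ccontr)
    assume "\<not> w r \<le> 0"
    then have wr: "w r > 0" by simp
    \<comment> \<open>With a positive slope the tangent falls to zero at this point to the left of
      \<open>r\<close>, and \<open>y\<close>, lying below it, could not be positive there.\<close>
    define a where "a = r * exp (- (y r / w r))"
    have yr: "y r > 0" using y0 r by auto
    have a: "0 < a" "a \<le> r" using r wr yr by (auto simp: a_def)
    have "ln a = ln r - y r / w r" using r by (simp add: a_def ln_mult)
    then have "y r = w r * (ln r - ln a)" using wr by simp
    then have "y a \<le> 0" using lower[OF a r(2)] by (simp add: algebra_simps)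
    then show False using y0[of a] a r by auto
  qed
  have y_mono: "y b \<le> y a" if "0 < a" "a \<le> b" "b < R" for a b
  proof (rule DERIV_nonpos_imp_nonincreasing[OF \<open>a \<le> b\<close>])
    fix x assume x: "a \<le> x" "x \<le> b"
    then have "y1 x \<le> 0" using w_le[of x] that by (simp add: w_def mult_le_0_iff)
    then show "\<exists>l. (y has_real_derivative l) (at x) \<and> l \<le> 0" using y[of x] x that by auto
  qed
  show thesis
  proof (rule that[OF c])
    fix r r0 assume r: "0 < r" "r < r0" "r0 < R"
    have yr: "y r > 0" using y0 r by auto
    \<comment> \<open>Integrability of \<open>s * V s\<close> comes from the equation:
      \<open>h\<close> is integrable on compact intervals, and dividing it by the continuous
      positive function \<open>y\<close> preserves this.\<close>
    have sV: "(\<lambda>s. s * V s) absolutely_integrable_on {a..r}" if a: "0 < a" "a < r" for a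
    proof -
      have ypos: "0 < y s" if "s \<in> {a..r}" for s using y0[of s] a r that by auto
      have "h absolutely_integrable_on {a..r}"
        using h[of a r] a r by (intro nonnegative_absolutely_integrable_1 h0) auto
      moreover have "continuous_on {a..r} y"
        using a r by (intro continuous_at_imp_continuous_on ballI DERIV_isCont[OF y]) auto
      then have "continuous_on {a..r} (\<lambda>s. 1 / y s)"
        by (intro continuous_on_divide continuous_on_const) (use ypos in \<open>force+\<close>)
      ultimately have "(\<lambda>s. 1 / y s * h s) absolutely_integrable_on {a..r}"
        by (rule absolutely_integrable_continuous_mult)
      moreover have "1 / y s * h s = s * V s" if "s \<in> {a..r}" for s
        using ypos[OF that] by (simp add: h_def)
      ultimately show ?thesis
        by (subst set_integrable_cong[OF refl refl, symmetric]) (auto simp: mult.commute)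
    qed
    show "(\<integral>\<^sup>+s\<in>{0<..<r}. ennreal (s * V s) \<partial>lebesgue) \<le> ennreal (1 / (c * ln (r0 / r)))"
    proof (rule nn_integral_Ioo_le[OF _ _ _ r(1)])
      show "(\<lambda>s. s * V s) integrable_on {a..r}" if "0 < a" "a < r" for a
        using sV[OF that] by (simp add: absolutely_integrable_on_def)
      show "0 \<le> x * V x" if "0 < x" "x \<le> r" for x using V0[of x] that r by auto
      fix a assume a: "0 < a" "a < r"
      \<comment> \<open>Since \<open>y\<close> is nonincreasing, \<open>y r\<close> is its least
        value on \<open>{a..r}\<close>, so \<open>h s / y r\<close> dominates
        \<open>s * V s\<close>. The term \<open>w a \<le> 0\<close> is then dropped, which makes the
        bound independent of \<open>a\<close>.\<close>
      have "integral {a..r} (\<lambda>s. s * V s) \<le> (w a - w r) / c * (1 / y r)"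
      proof (rule has_integral_le)
        show "((\<lambda>s. s * V s) has_integral integral {a..r} (\<lambda>s. s * V s)) {a..r}"
          using sV[OF a] by (simp add: absolutely_integrable_on_def integrable_integral)
        show "((\<lambda>s. h s * (1 / y r)) has_integral (w a - w r) / c * (1 / y r)) {a..r}"
          using a r by (intro has_integral_mult_left h) auto
        fix s assume s: "s \<in> {a..r}"
        then have "s * V s * y r \<le> s * V s * y s"
          using a r V0[of s] by (intro mult_left_mono y_mono) auto
        then show "s * V s \<le> h s * (1 / y r)"
          using yr by (simp add: h_def field_simps)
      qed
      also have "\<dots> \<le> - w r / (c * y r)"
        using divide_right_mono[of "w a - w r" "- w r" "c * y r"] w_le[of a] a r c yr by simp
      also have "\<dots> \<le> 1 / (c * ln (r0 / r))"
      proof -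
        have l: "ln (r0 / r) > 0" using r by simp
        \<comment> \<open>The tangent at \<open>r\<close> lies above \<open>y r0 > 0\<close> when
          evaluated at \<open>r0\<close>, which limits how steeply \<open>y\<close> can fall at
          \<open>r\<close>.\<close>
        have "- w r * ln (r0 / r) \<le> y r"
          using upper[of r r r0] y0[of r0] r by (simp add: ln_div algebra_simps)
        then show ?thesis using l yr c by (simp add: divide_simps mult.commute)
      qed
      finally show "integral {a..r} (\<lambda>s. s * V s) \<le> 1 / (c * ln (r0 / r))" .
    qed
  qed
qed

section \<open>From a moment bound to a positive solution, through the Riccati equation\<close>

text \<open>The integrand is the Riccati term \<open>u\<^sup>2 / s\<close> for the supersolution
  \<open>u = 1 / (2 * ln (\<rho> / s))\<close>, and its antiderivative is
  \<open>u / 2\<close>.\<close>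

lemma integral_inverse_ln_square:
  fixes \<rho> r :: real
  assumes r: "0 < a" "a \<le> r" "r < \<rho>"
  shows "((\<lambda>s. 1 / (4 * s * (ln (\<rho> / s))\<^sup>2)) has_integral 1 / (4 * ln (\<rho> / r)) - 1 / (4 * ln (\<rho> / a))) {a..r}"
proof (rule fundamental_theorem_of_calculus[OF r(2)])
  fix x assume x: "x \<in> {a..r}"
  then have l: "ln (\<rho> / x) > 0" using r by simp
  have "((\<lambda>s. 1 / (4 * ln (\<rho> / s))) has_real_derivative 1 / (4 * x * (ln (\<rho> / x))\<^sup>2)) (at x)"
    using l x r by (auto intro!: derivative_eq_intros simp: field_simps power2_eq_square)
  then show "((\<lambda>s. 1 / (4 * ln (\<rho> / s))) has_vector_derivative 1 / (4 * x * (ln (\<rho> / x))\<^sup>2)) (at x within {a..r})"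
    by (simp add: has_real_derivative_iff_has_vector_derivative has_vector_derivative_at_within)
qed

lemma nn_integral_inverse_ln_square:
  fixes \<rho> r :: real
  assumes r: "0 < r" "r < \<rho>"
  shows "(\<integral>\<^sup>+s\<in>{0<..<r}. ennreal (1 / (4 * s * (ln (\<rho> / s))\<^sup>2)) \<partial>lebesgue) \<le> ennreal (1 / (4 * ln (\<rho> / r)))"
proof (rule nn_integral_Ioo_le[OF _ _ _ r(1)])
  fix a assume a: "0 < a" "a < r"
  note i = integral_inverse_ln_square[of a r \<rho>]
  show "(\<lambda>s. 1 / (4 * s * (ln (\<rho> / s))\<^sup>2)) integrable_on {a..r}"
    using i a r by auto
  have "ln (\<rho> / a) > 0" using a r by simp
  then show "integral {a..r} (\<lambda>s. 1 / (4 * s * (ln (\<rho> / s))\<^sup>2)) \<le> 1 / (4 * ln (\<rho> / r))"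
    using i[THEN integral_unique] a r by simp
qed auto

text \<open>The constant 4 in the bound balances the supersolution
  \<open>1 / (2 * ln (\<rho> / r))\<close>: the integral of \<open>f\<close> and that of the
  quadratic term each take up at most half of it.\<close>

lemma riccati_integral_equation:
  fixes f :: "real \<Rightarrow> real"
  assumes f0: "\<And>r. 0 < r \<Longrightarrow> 0 \<le> f r"
    and f: "\<And>a b. 0 < a \<Longrightarrow> a \<le> b \<Longrightarrow> f absolutely_integrable_on {a..b}"
    and R: "R \<le> \<rho>"
    and bound: "\<And>r. 0 < r \<Longrightarrow> r < R \<Longrightarrow>
      (\<integral>\<^sup>+s\<in>{0<..<r}. ennreal (f s) \<partial>lebesgue) \<le> ennreal (1 / (4 * ln (\<rho> / r)))"
  obtains u where
    "\<And>a b. 0 < a \<Longrightarrow> a \<le> b \<Longrightarrow> b < R \<Longrightarrow> (\<lambda>s. f s + (u s)\<^sup>2 / s) absolutely_integrable_on {a..b}"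
    "\<And>a b. 0 < a \<Longrightarrow> a \<le> b \<Longrightarrow> b < R \<Longrightarrow> u b - u a = integral {a..b} (\<lambda>s. f s + (u s)\<^sup>2 / s)"
proof -
  \<comment> \<open>The integral \<open>nn_integral\<close> is monotone on nonmeasurable functions too, so no
    measurability is needed to have a fixed point; it follows from \<open>T v\<close> being monotone in \<open>r\<close>.\<close>
  define T :: "(real \<Rightarrow> ennreal) \<Rightarrow> real \<Rightarrow> ennreal" where
    "T = (\<lambda>v r. \<integral>\<^sup>+s\<in>{0<..<r}. (ennreal (f s) + v s ^ 2 * ennreal (1 / s)) \<partial>lebesgue)"
  \<comment> \<open>The value \<open>top\<close> from \<open>R\<close> on makes
    \<open>T B \<le> B\<close> trivial there. For \<open>r \<le> 0\<close> the domain of integration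
    is empty and \<open>T B r = 0\<close>, so only \<open>0 < r < R\<close> needs the
    estimate.\<close>
  define B :: "real \<Rightarrow> ennreal" where
    "B = (\<lambda>r. if r < R then ennreal (1 / (2 * ln (\<rho> / r))) else top)"
  define v where "v = lfp T"
  have "mono T"
    unfolding T_def
    by (intro monoI le_funI nn_integral_mono mult_right_mono add_left_mono power_mono) (auto dest: le_funD)
  then have v: "v = T v" unfolding v_def by (rule lfp_unfold)
  have "T B \<le> B"
  proof (rule le_funI)
    fix r
    consider "r \<ge> R" | "r \<le> 0" "r < R" | "0 < r" "r < R" by linarith
    then show "T B r \<le> B r"
    proof cases
      case 3
      define g where "g = (\<lambda>s. 1 / (4 * s * (ln (\<rho> / s))\<^sup>2))"
      have L: "ln (\<rho> / r) > 0" using 3 R by simp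
      have "T B r = (\<integral>\<^sup>+s. ennreal (f s) * indicator {0<..<r} s + ennreal (g s) * indicator {0<..<r} s \<partial>lebesgue)"
        unfolding T_def
      proof (intro nn_integral_cong)
        fix s
        show "(ennreal (f s) + (B s)\<^sup>2 * ennreal (1 / s)) * indicator {0<..<r} s =
            ennreal (f s) * indicator {0<..<r} s + ennreal (g s) * indicator {0<..<r} s"
        proof (cases "s \<in> {0<..<r}")
          case True
          have "ln (\<rho> / s) > 0" using 3 R True by simp
          then have "(B s)\<^sup>2 * ennreal (1 / s) = ennreal ((1 / (2 * ln (\<rho> / s)))\<^sup>2 * (1 / s))"
            using True 3 by (simp add: B_def ennreal_mult[symmetric] ennreal_power)
          also have "(1 / (2 * ln (\<rho> / s)))\<^sup>2 * (1 / s) = g s"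
            by (simp add: g_def power2_eq_square)
          finally show ?thesis using True by simp
        qed auto
      qed
      also have "\<dots> = (\<integral>\<^sup>+s\<in>{0<..<r}. ennreal (f s) \<partial>lebesgue) + (\<integral>\<^sup>+s\<in>{0<..<r}. ennreal (g s) \<partial>lebesgue)"
      proof (rule nn_integral_add)
        have meas: "(\<lambda>s. ennreal (k s) * indicator {0<..<r} s) \<in> borel_measurable lebesgue"
          if "\<And>a b. 0 < a \<Longrightarrow> a \<le> b \<Longrightarrow> b < r \<Longrightarrow> k absolutely_integrable_on {a..b}" for k :: "real \<Rightarrow> real"
        proof -
          have "(\<lambda>s. ennreal (indicator {0<..<r} s * k s)) \<in> borel_measurable lebesgue"
            using borel_measurable_locally_integrable[OF that] by measurable
          moreover have "ennreal (indicator {0<..<r} s * k s) = ennreal (k s) * indicator {0<..<r} s" for s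
            by (simp split: split_indicator)
          ultimately show ?thesis by simp
        qed
        show "(\<lambda>s. ennreal (f s) * indicator {0<..<r} s) \<in> borel_measurable lebesgue"
          by (intro meas f)
        show "(\<lambda>s. ennreal (g s) * indicator {0<..<r} s) \<in> borel_measurable lebesgue"
        proof (rule meas)
          fix a b assume ab: "0 < a" "a \<le> b" "b < r"
          then have "b < \<rho>" using 3 R by simp
          then show "g absolutely_integrable_on {a..b}"
            using integral_inverse_ln_square[of a b \<rho>] ab unfolding g_def
            by (intro nonnegative_absolutely_integrable_1) auto
        qed
      qed
      also have "\<dots> \<le> ennreal (1 / (4 * ln (\<rho> / r))) + ennreal (1 / (4 * ln (\<rho> / r)))"
        unfolding g_def using 3 R by (intro add_mono bound nn_integral_inverse_ln_square) auto
      also have "\<dots> = B r"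
        using L 3 by (simp add: B_def ennreal_plus[symmetric] del: ennreal_plus)
      finally show ?thesis .
    qed (auto simp: T_def B_def)
  qed
  then have vB: "v r \<le> B r" for r
    unfolding v_def by (metis lfp_lowerbound le_funD)
  have v_mono: "v a \<le> v b" if "a \<le> b" for a b
  proof -
    have "T v a \<le> T v b"
      unfolding T_def using that
      by (intro nn_integral_mono mult_left_mono) (auto split: split_indicator)
    then show ?thesis using v by metis
  qed
  define u where "u = (\<lambda>r. enn2real (v r))"
  have u0: "0 \<le> u r" for r by (simp add: u_def)
  have vu: "v r = ennreal (u r)" if "r < R" for r
  proof -
    have "v r < top" using vB[of r] that by (auto simp: B_def intro: le_less_trans)
    then show ?thesis by (simp add: u_def)
  qed
  have u_mono: "u a \<le> u b" if "a \<le> b" "b < R" for a b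
    using v_mono[OF that(1)] vu[of a] vu[of b] that u0 by simp
  define q where "q = (\<lambda>s. f s + (u s)\<^sup>2 / s)"
  have q0: "0 \<le> q s" if "0 < s" for s using f0 that by (simp add: q_def)
  have q_int: "q absolutely_integrable_on {a..b}" if ab: "0 < a" "a \<le> b" "b < R" for a b
  proof -
    \<comment> \<open>A monotone function is integrable on a compact interval, and
      \<open>1 / s\<close> is continuous away from 0.\<close>
    have "mono_on {a..b} (\<lambda>s. (u s)\<^sup>2)"
      using ab u0 u_mono by (intro mono_onI power_mono) auto
    then have "(\<lambda>s. (u s)\<^sup>2) absolutely_integrable_on {a..b}"
      by (intro nonnegative_absolutely_integrable_1 integrable_on_mono_on) auto
    moreover have "continuous_on {a..b} (\<lambda>s. 1 / s)"
      using ab by (intro continuous_intros) auto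
    ultimately have "(\<lambda>s. 1 / s * (u s)\<^sup>2) absolutely_integrable_on {a..b}"
      by (rule absolutely_integrable_continuous_mult)
    then have "(\<lambda>s. f s + 1 / s * (u s)\<^sup>2) absolutely_integrable_on {a..b}"
      by (intro set_integral_add f ab)
    then show ?thesis by (simp add: q_def)
  qed
  have u_eq: "u b - u a = integral {a..b} q" if ab: "0 < a" "a \<le> b" "b < R" for a b
  proof -
    \<comment> \<open>The cutoff makes the integrand measurable on the whole line, so
      \<open>v = T v\<close> can be split additively at \<open>a\<close>. All values are finite
      below \<open>R\<close> because \<open>v \<le> B\<close>, hence the extended identity can be
      read in the reals.\<close>
    define Q where "Q = (\<lambda>s. ennreal (indicator {0<..<R} s * q s))"
    have [measurable]: "Q \<in> borel_measurable lebesgue"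
      unfolding Q_def using borel_measurable_locally_integrable[OF q_int] by measurable
    have Tv: "T v r = (\<integral>\<^sup>+s\<in>{0<..<r}. Q s \<partial>lebesgue)" if "r < R" for r
      unfolding T_def
    proof (intro nn_integral_cong)
      fix s
      show "(ennreal (f s) + (v s)\<^sup>2 * ennreal (1 / s)) * indicator {0<..<r} s = Q s * indicator {0<..<r} s"
        using that f0[of s] u0[of s] vu[of s]
        by (auto simp: Q_def q_def ennreal_mult'[symmetric] ennreal_power split: split_indicator)
    qed
    have "ennreal (u b) = T v b" using vu[OF ab(3)] v by metis
    also have "T v b = (\<integral>\<^sup>+s\<in>{0<..<a} \<union> {a..<b}. Q s \<partial>lebesgue)"
      using ab by (simp add: Tv ivl_disj_un)
    also have "\<dots> = (\<integral>\<^sup>+s\<in>{0<..<a}. Q s \<partial>lebesgue) + (\<integral>\<^sup>+s\<in>{a..<b}. Q s \<partial>lebesgue)"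
      by (intro nn_integral_disjoint_pair) auto
    also have "(\<integral>\<^sup>+s\<in>{0<..<a}. Q s \<partial>lebesgue) = ennreal (u a)"
      using ab vu[of a] Tv[of a] v by (metis le_less_trans)
    also have "(\<integral>\<^sup>+s\<in>{a..<b}. Q s \<partial>lebesgue) = (\<integral>\<^sup>+s\<in>{a..b}. Q s \<partial>lebesgue)"
    proof (rule nn_integral_null_delta)
      have "({a..<b} - {a..b}) \<union> ({a..b} - {a..<b}) \<subseteq> {b}" by auto
      then have "negligible (({a..<b} - {a..b}) \<union> ({a..b} - {a..<b}))"
        by (rule negligible_subset[rotated]) simp
      then show "({a..<b} - {a..b}) \<union> ({a..b} - {a..<b}) \<in> null_sets lebesgue"
        by (simp add: negligible_iff_null_sets)
    qed auto
    also have "\<dots> = (\<integral>\<^sup>+s\<in>{a..b}. ennreal (q s) \<partial>lebesgue)"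
      using ab by (intro nn_integral_cong) (auto simp: Q_def split: split_indicator)
    also have "\<dots> = ennreal (integral {a..b} q)"
      using q_int[OF ab] q0 ab
      by (intro nn_integral_eq_integral) (auto simp: absolutely_integrable_on_def)
    also have "ennreal (u a) + \<dots> = ennreal (u a + integral {a..b} q)"
      using q_int[OF ab] q0 ab u0
      by (intro ennreal_plus[symmetric] integral_nonneg) (auto simp: absolutely_integrable_on_def)
    finally have "ennreal (u b) = ennreal (u a + integral {a..b} q)" .
    moreover have "0 \<le> integral {a..b} q"
      using q_int[OF ab] q0 ab by (intro integral_nonneg) (auto simp: absolutely_integrable_on_def)
    ultimately show ?thesis using u0 by (simp del: ennreal_plus)
  qed
  show thesis using that[of u] q_int u_eq unfolding q_def by blast
qed

text \<open>For \<open>y' = - u * y / r\<close>, the quadratic term of the Riccati equation cancels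
  the one produced by differentiating \<open>y\<close> inside \<open>y'\<close>. As \<open>u\<close>
  is only absolutely continuous, \<open>y''\<close> is obtained from the integral product
  rule.\<close>

lemma positive_solution_from_riccati:
  fixes u V :: "real \<Rightarrow> real"
  assumes R: "0 < R"
    and int: "\<And>a b. 0 < a \<Longrightarrow> a \<le> b \<Longrightarrow> b < R \<Longrightarrow>
      (\<lambda>s. c * (s * V s) + (u s)\<^sup>2 / s) absolutely_integrable_on {a..b}"
    and eq: "\<And>a b. 0 < a \<Longrightarrow> a \<le> b \<Longrightarrow> b < R \<Longrightarrow>
      u b - u a = integral {a..b} (\<lambda>s. c * (s * V s) + (u s)\<^sup>2 / s)"
  obtains y where "\<And>r. 0 < y r" "bessel_caratheodory_solution V c R y"
proof -
  define q where "q = (\<lambda>s. c * (s * V s) + (u s)\<^sup>2 / s)"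
  note int = int[folded q_def] and eq = eq[folded q_def]
  have cont_u: "continuous_on {a..b} u" if ab: "0 < a" "a \<le> b" "b < R" for a b
  proof -
    have "continuous_on {a..b} (\<lambda>x. u a + integral {a..x} q)"
      using int[OF ab]
      by (intro continuous_intros indefinite_integral_continuous_1)
        (auto simp: absolutely_integrable_on_def)
    moreover have "u a + integral {a..x} q = u x" if "x \<in> {a..b}" for x
      using eq[of a x] that ab by auto
    ultimately show ?thesis by (rule continuous_on_eq)
  qed
  have isCont_u: "isCont u r" if r: "0 < r" "r < R" for r
  proof -
    have "continuous_on {r/2..(r+R)/2} u" using r by (intro cont_u) auto
    moreover have "r \<in> interior {r/2..(r+R)/2}" using r by auto
    ultimately show ?thesis by (rule continuous_on_interior)
  qed
  \<comment> \<open>An antiderivative on the open interval suffices, so convergence of the integral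
    of \<open>u x / x\<close> at 0 does not enter.\<close>
  obtain G where G: "\<And>x. 0 < x \<Longrightarrow> x < R \<Longrightarrow> (G has_real_derivative u x / x) (at x)"
    using einterval_antiderivative[of 0 "ereal R" "\<lambda>x. u x / x"] R isCont_u
    by (force simp: has_real_derivative_iff_has_vector_derivative)
  define y where "y = (\<lambda>x. exp (- G x))"
  \<comment> \<open>The factorization \<open>y' = u * p\<close> isolates the absolutely continuous
    factor \<open>u\<close>; \<open>p\<close> has the continuous derivative \<open>p'\<close>, as
    the product rule requires.\<close>
  define p where "p = (\<lambda>x. - (y x / x))"
  define p' where "p' = (\<lambda>x. (u x + 1) * y x / x\<^sup>2)"
  have y: "(y has_real_derivative u x * p x) (at x)" if "0 < x" "x < R" for x
    unfolding y_def p_def by (rule derivative_eq_intros G that refl | simp)+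
  have p: "(p has_real_derivative p' x) (at x)" if "0 < x" "x < R" for x
  proof -
    have "(p has_real_derivative - ((u x * p x * x - y x * 1) / (x * x))) (at x)"
      unfolding p_def using that y[OF that, unfolded p_def]
      by (intro DERIV_minus DERIV_divide DERIV_ident) auto
    moreover have "- ((u x * p x * x - y x * 1) / (x * x)) = p' x"
      using that by (simp add: p_def p'_def field_simps power2_eq_square)
    ultimately show ?thesis by simp
  qed
  have prod: "(\<lambda>x. q x * p x + u x * p' x) absolutely_integrable_on {a..b} \<and>
      integral {a..b} (\<lambda>x. q x * p x + u x * p' x) = u b * p b - u a * p a"
    if ab: "0 < a" "a \<le> b" "b < R" for a b
  proof -
    have u: "u x - u a = integral {a..x} q" if "x \<in> {a..b}" for x
      using eq[of a x] that ab by simp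
    have dp: "(p has_real_derivative p' x) (at x within {a..b})" if "x \<in> {a..b}" for x
      using p[of x] that ab by (auto intro: has_field_derivative_at_within)
    have "continuous_on {a..b} y"
      using ab by (intro continuous_at_imp_continuous_on ballI DERIV_isCont[OF y]) auto
    then have cp: "continuous_on {a..b} p'"
      unfolding p'_def using ab by (intro continuous_intros cont_u) auto
    show ?thesis
      using integral_product_rule[OF ab(2) int[OF ab] u dp cp] by simp
  qed
  have ode: "(q r * p r + u r * p' r) + (u r * p r) / r + c * V r * y r = 0" if "0 < r" for r
    using that by (simp add: q_def p_def p'_def field_simps power2_eq_square)
  show thesis
  proof (rule that)
    show "0 < y r" for r by (simp add: y_def)
    show "bessel_caratheodory_solution V c R y"
      unfolding bessel_caratheodory_solution_def
      using y prod ode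
      by (intro exI[of _ "\<lambda>r. u r * p r"] exI[of _ "\<lambda>r. q r * p r + u r * p' r"]) auto
  qed
qed

lemma caratheodory_potential_of_moment_bound:
  fixes V :: "real \<Rightarrow> real"
  assumes V0: "\<And>r. 0 < r \<Longrightarrow> 0 \<le> V r"
    and V: "\<And>a b. 0 < a \<Longrightarrow> a \<le> b \<Longrightarrow> V absolutely_integrable_on {a..b}"
    and R: "0 < R" "R \<le> \<rho>" and K: "0 < K"
    and bound: "\<And>r. 0 < r \<Longrightarrow> r < R \<Longrightarrow>
      (\<integral>\<^sup>+s\<in>{0<..<r}. ennreal (s * V s) \<partial>lebesgue) \<le> ennreal (K / ln (\<rho> / r))"
  shows "bessel_potential_caratheodory V R"
proof -
  \<comment> \<open>This coupling constant turns the bound \<open>K / ln (\<rho> / r)\<close> into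
    the \<open>1 / (4 * ln (\<rho> / r))\<close> that the Riccati argument needs.\<close>
  define c where "c = 1 / (4 * K)"
  have c: "c > 0" using K by (simp add: c_def)
  define f where "f = (\<lambda>s. c * (s * V s))"
  have f: "f absolutely_integrable_on {a..b}" if "0 < a" "a \<le> b" for a b
    unfolding f_def
    using absolutely_integrable_continuous_mult[OF V[OF that], of "\<lambda>s. c * s"]
    by (simp add: continuous_intros mult.assoc)
  have "(\<integral>\<^sup>+s\<in>{0<..<r}. ennreal (f s) \<partial>lebesgue) \<le> ennreal (1 / (4 * ln (\<rho> / r)))"
    if r: "0 < r" "r < R" for r
  proof -
    have l: "ln (\<rho> / r) > 0" using r R by simp
    have "(\<lambda>s. ennreal ((1 / c) * (indicator {0<..<r} s * f s))) \<in> borel_measurable lebesgue"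
      using borel_measurable_locally_integrable[of r f] f by measurable
    moreover have "ennreal ((1 / c) * (indicator {0<..<r} s * f s)) = ennreal (s * V s) * indicator {0<..<r} s" for s
      using c by (simp add: f_def split: split_indicator)
    ultimately have meas: "(\<lambda>s. ennreal (s * V s) * indicator {0<..<r} s) \<in> borel_measurable lebesgue"
      by simp
    have "(\<integral>\<^sup>+s\<in>{0<..<r}. ennreal (f s) \<partial>lebesgue) =
        (\<integral>\<^sup>+s. ennreal c * (ennreal (s * V s) * indicator {0<..<r} s) \<partial>lebesgue)"
      using c by (intro nn_integral_cong) (auto simp: f_def ennreal_mult' split: split_indicator)
    also have "\<dots> = ennreal c * (\<integral>\<^sup>+s\<in>{0<..<r}. ennreal (s * V s) \<partial>lebesgue)"
      by (rule nn_integral_cmult[OF meas])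
    also have "\<dots> \<le> ennreal c * ennreal (K / ln (\<rho> / r))"
      by (intro mult_left_mono bound r) auto
    also have "\<dots> = ennreal (c * (K / ln (\<rho> / r)))"
      using c K l by (simp add: ennreal_mult[symmetric])
    also have "c * (K / ln (\<rho> / r)) = 1 / (4 * ln (\<rho> / r))"
      using K by (simp add: c_def)
    finally show ?thesis .
  qed
  then obtain u where
    "\<And>a b. 0 < a \<Longrightarrow> a \<le> b \<Longrightarrow> b < R \<Longrightarrow> (\<lambda>s. f s + (u s)\<^sup>2 / s) absolutely_integrable_on {a..b}"
    "\<And>a b. 0 < a \<Longrightarrow> a \<le> b \<Longrightarrow> b < R \<Longrightarrow> u b - u a = integral {a..b} (\<lambda>s. f s + (u s)\<^sup>2 / s)"
    using riccati_integral_equation[of f R \<rho>] f R V0 c by (auto simp: f_def)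
  then obtain y where "\<And>r. 0 < y r" "bessel_caratheodory_solution V c R y"
    using positive_solution_from_riccati[of R c V u] R unfolding f_def by blast
  then show ?thesis
    unfolding bessel_potential_caratheodory_def using c V0 by auto
qed

section \<open>The two halves, by rescaling\<close>

theorem proposition5p2:
  fixes W :: "real \<Rightarrow> real"
  assumes pos: "\<And>r. 0 < r \<Longrightarrow> 0 < W r"
    and loc_int: "\<And>a b. 0 < a \<Longrightarrow> a \<le> b \<Longrightarrow> W absolutely_integrable_on {a..b}"
  shows "(Liminf (at_right 0) (log_moment W) > -\<infinity> \<longrightarrow>
            (\<forall>R>0. \<exists>\<alpha>>0.
               bessel_potential_caratheodory (\<lambda>x. \<alpha>^2 * W (\<alpha> * x)) R \<and>
               ((\<lambda>x. \<alpha>^2 * W (\<alpha> * x)) C1_differentiable_on {0<..<R} \<longrightarrow>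
                  bessel_potential (\<lambda>x. \<alpha>^2 * W (\<alpha> * x)) R)))
       \<and> ((log_moment W \<longlongrightarrow> -\<infinity>) (at_right 0) \<longrightarrow>
            (\<forall>R>0. \<not> (\<exists>\<alpha>>0. \<exists>c>0.
               bessel_potential_caratheodory (\<lambda>x. c * W (\<alpha> * \<bar>x\<bar>)) R \<or>
               bessel_potential (\<lambda>x. c * W (\<alpha> * \<bar>x\<bar>)) R)))"
proof (intro conjI impI allI notI)
  fix R :: real
  assume L: "Liminf (at_right 0) (log_moment W) > -\<infinity>" and R: "R > 0"
  obtain m where "ereal m < Liminf (at_right 0) (log_moment W)"
    using ereal_dense2[OF L] by blast
  then have "eventually (\<lambda>r. ereal m < log_moment W r) (at_right 0)"
    by (rule less_LiminfD)
  then obtain b where b: "b > 0" "\<And>r. 0 < r \<Longrightarrow> r < b \<Longrightarrow> ereal m < log_moment W r"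
    using eventually_at_right[of 0 "1::real"] by auto
  \<comment> \<open>Capping at 1 makes \<open>ln r\<close> negative for \<open>r < \<delta>\<close>.
    The lower bound \<open>m\<close> on \<open>log_moment\<close> then becomes an upper bound on the
    moment, and an infinite moment is excluded because it would give
    \<open>-\<infinity>\<close>.\<close>
  define \<delta> where "\<delta> = min b 1"
  have \<delta>: "0 < \<delta>" "\<delta> \<le> 1" "\<delta> \<le> b" using b by (auto simp: \<delta>_def)
  define K where "K = \<bar>m\<bar> + 1"
  have moment: "(\<integral>\<^sup>+s\<in>{0<..<r}. ennreal (s * W s) \<partial>lebesgue) \<le> ennreal (K / ln (1 / r))"
    if r: "0 < r" "r < \<delta>" for r
  proof -
    have l: "ln r < 0" using r \<delta> by simp
    have *: "ereal m < ereal (ln r) * enn2ereal (\<integral>\<^sup>+s\<in>{0<..<r}. ennreal (s * W s) \<partial>lebesgue)"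
      using b(2)[of r] r \<delta> by (simp add: log_moment_def)
    show ?thesis
    proof (cases "\<integral>\<^sup>+s\<in>{0<..<r}. ennreal (s * W s) \<partial>lebesgue" rule: ennreal_cases)
      case (real x)
      then have "m < ln r * x" using * by (simp add: enn2ereal_ennreal)
      then have "x * (- ln r) \<le> K" by (simp add: K_def mult.commute)
      then have "x \<le> K / (- ln r)" using l by (subst pos_le_divide_eq) auto
      then show ?thesis using real r by (simp add: ln_div ennreal_leI)
    next
      case top
      then show ?thesis using * l by simp
    qed
  qed
  \<comment> \<open>This scaling maps \<open>{0<..<R}\<close> onto \<open>{0<..<\<delta>}\<close>,
    where the moment is controlled. The bound at \<open>\<alpha> * r\<close> has the required form
    with \<open>\<rho> = 1 / \<alpha>\<close>, and \<open>\<delta> \<le> 1\<close> gives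
    \<open>R \<le> \<rho>\<close>.\<close>
  define \<alpha> where "\<alpha> = \<delta> / R"
  have \<alpha>: "\<alpha> > 0" "\<alpha> * R = \<delta>" using \<delta> R by (auto simp: \<alpha>_def)
  have pot: "bessel_potential_caratheodory (\<lambda>x. \<alpha>^2 * W (\<alpha> * x)) R"
  proof (rule caratheodory_potential_of_moment_bound)
    show "0 \<le> \<alpha>\<^sup>2 * W (\<alpha> * r)" if "0 < r" for r
      using pos[of "\<alpha> * r"] that \<alpha> by simp
    show "(\<lambda>x. \<alpha>\<^sup>2 * W (\<alpha> * x)) absolutely_integrable_on {a..b}" if ab: "0 < a" "a \<le> b" for a b
    proof -
      \<comment> \<open>The change of variables supplies one factor \<open>\<alpha>\<close> as
        Jacobian; the other is a constant multiple.\<close>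
      have "W absolutely_integrable_on (\<lambda>x. \<alpha> * x) ` {a..b}"
        using ab \<alpha> by (simp add: image_mult_atLeastAtMost loc_int)
      then have "(\<lambda>x. \<bar>\<alpha>\<bar> * W (\<alpha> * x)) absolutely_integrable_on {a..b}"
        using \<alpha> by (subst absolutely_integrable_change_of_variables_1'[symmetric])
          (auto intro!: derivative_eq_intros inj_onI)
      then have "(\<lambda>x. \<alpha> * (\<alpha> * W (\<alpha> * x))) absolutely_integrable_on {a..b}"
        using \<alpha> by (intro absolutely_integrable_continuous_mult continuous_on_const) simp
      then show ?thesis by (simp add: power2_eq_square mult.assoc)
    qed
    show "0 < R" "0 < K" using R by (auto simp: K_def)
    show "R \<le> 1 / \<alpha>" using \<alpha> \<delta> by (simp add: pos_le_divide_eq mult.commute)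
    fix r assume r: "0 < r" "r < R"
    have "\<alpha> * r < \<delta>" using r \<alpha> by (metis mult_strict_left_mono)
    then have "(\<integral>\<^sup>+s\<in>{0<..<\<alpha> * r}. ennreal (s * W s) \<partial>lebesgue) \<le> ennreal (K / ln (1 / (\<alpha> * r)))"
      using r \<alpha> by (intro moment) auto
    moreover have "(\<integral>\<^sup>+s\<in>{0<..<r}. ennreal (s * (\<alpha>\<^sup>2 * W (\<alpha> * s))) \<partial>lebesgue) =
        (\<integral>\<^sup>+s\<in>{0<..<\<alpha> * r}. ennreal (s * W s) \<partial>lebesgue)"
      using moment_scaling[OF loc_int \<alpha>(1), of "\<alpha>\<^sup>2" r] \<alpha> by (simp add: ennreal_mult_cancel_left)
    ultimately show "(\<integral>\<^sup>+s\<in>{0<..<r}. ennreal (s * (\<alpha>\<^sup>2 * W (\<alpha> * s))) \<partial>lebesgue) \<le> ennreal (K / ln (1 / \<alpha> / r))"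
      by simp
  qed
  then show "\<exists>\<alpha>>0. bessel_potential_caratheodory (\<lambda>x. \<alpha>^2 * W (\<alpha> * x)) R \<and>
      ((\<lambda>x. \<alpha>^2 * W (\<alpha> * x)) C1_differentiable_on {0<..<R} \<longrightarrow>
        bessel_potential (\<lambda>x. \<alpha>^2 * W (\<alpha> * x)) R)"
    using \<alpha>(1) bessel_potential_iff_caratheodory by blast
next
  fix R :: real
  assume L: "(log_moment W \<longlongrightarrow> -\<infinity>) (at_right 0)" and R: "R > 0"
  assume "\<exists>\<alpha>>0. \<exists>c>0. bessel_potential_caratheodory (\<lambda>x. c * W (\<alpha> * \<bar>x\<bar>)) R \<or>
      bessel_potential (\<lambda>x. c * W (\<alpha> * \<bar>x\<bar>)) R"
  then obtain \<alpha> c where \<alpha>: "\<alpha> > 0" and c: "c > 0"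
    and "bessel_potential_caratheodory (\<lambda>x. c * W (\<alpha> * \<bar>x\<bar>)) R \<or>
      bessel_potential (\<lambda>x. c * W (\<alpha> * \<bar>x\<bar>)) R" by blast
  \<comment> \<open>A classical potential is \<open>C1\<close> by definition, so for it the two
    notions coincide.\<close>
  then have "bessel_potential_caratheodory (\<lambda>x. c * W (\<alpha> * \<bar>x\<bar>)) R"
    using bessel_potential_iff_caratheodory bessel_potential_def by blast
  then obtain d where d: "d > 0"
    and bound: "\<And>r r0. 0 < r \<Longrightarrow> r < r0 \<Longrightarrow> r0 < R \<Longrightarrow>
      (\<integral>\<^sup>+s\<in>{0<..<r}. ennreal (s * (c * W (\<alpha> * \<bar>s\<bar>))) \<partial>lebesgue) \<le> ennreal (1 / (d * ln (r0 / r)))"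
    using caratheodory_moment_bound by blast
  \<comment> \<open>\<open>R / 2\<close> serves as the reference radius \<open>r0\<close> below
    \<open>R\<close>. Undoing the scaling moves it to \<open>\<rho>\<close> and multiplies the bound
    \<open>1 / (d * ln (\<rho> / t))\<close> by \<open>\<alpha>\<^sup>2 / c\<close>.\<close>
  define C where "C = \<alpha>\<^sup>2 / (c * d)"
  define \<rho> where "\<rho> = \<alpha> * (R / 2)"
  have \<rho>: "\<rho> > 0" using \<alpha> R by (simp add: \<rho>_def)
  have C: "C > 0" using \<alpha> c d by (simp add: C_def)
  have moment: "(\<integral>\<^sup>+s\<in>{0<..<t}. ennreal (s * W s) \<partial>lebesgue) \<le> ennreal (C / ln (\<rho> / t))"
    if t: "0 < t" "t < \<rho>" for t
  proof -
    define r where "r = t / \<alpha>"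
    have r: "0 < r" "r < R / 2" "\<alpha> * r = t" "(R / 2) / r = \<rho> / t"
      using t \<alpha> by (auto simp: r_def \<rho>_def field_simps)
    have l: "ln (\<rho> / t) > 0" using t by simp
    have "ennreal c * (\<integral>\<^sup>+s\<in>{0<..<t}. ennreal (s * W s) \<partial>lebesgue) =
        ennreal (\<alpha>\<^sup>2) * (\<integral>\<^sup>+s\<in>{0<..<r}. ennreal (s * (c * W (\<alpha> * s))) \<partial>lebesgue)"
      using moment_scaling[OF loc_int \<alpha>, of c r] c r by simp
    also have "(\<integral>\<^sup>+s\<in>{0<..<r}. ennreal (s * (c * W (\<alpha> * s))) \<partial>lebesgue) =
        (\<integral>\<^sup>+s\<in>{0<..<r}. ennreal (s * (c * W (\<alpha> * \<bar>s\<bar>))) \<partial>lebesgue)"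
      by (intro nn_integral_cong) (auto split: split_indicator)
    also have "ennreal (\<alpha>\<^sup>2) * \<dots> \<le> ennreal (\<alpha>\<^sup>2) * ennreal (1 / (d * ln (\<rho> / t)))"
      using bound[of r "R / 2"] r R by (intro mult_left_mono) auto
    also have "\<dots> = ennreal (\<alpha>\<^sup>2 * (1 / (d * ln (\<rho> / t))))"
      using d l by (simp add: ennreal_mult[symmetric])
    also have "\<alpha>\<^sup>2 * (1 / (d * ln (\<rho> / t))) = c * (C / ln (\<rho> / t))"
      using c by (simp add: C_def)
    also have "ennreal \<dots> = ennreal c * ennreal (C / ln (\<rho> / t))"
      using c C l by (intro ennreal_mult) auto
    finally show ?thesis
      using c by (simp add: ennreal_mult_le_mult_iff)
  qed
  \<comment> \<open>The three bounds on \<open>t\<close> make \<open>ln t\<close> negative,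
    \<open>ln (\<rho> / t)\<close> positive, and \<open>- ln t \<le> 2 * ln (\<rho> / t)\<close>,
    the last being \<open>t \<le> \<rho>\<^sup>2\<close>. Together with the moment bound they force
    \<open>log_moment W t \<ge> - 2 * C\<close>, against the threshold chosen here.\<close>
  have "eventually (\<lambda>t. log_moment W t < ereal (- 2 * C)) (at_right 0)"
    using L by (rule order_tendstoD) simp
  moreover have "eventually (\<lambda>t. 0 < t \<and> t < Min {1, \<rho>, \<rho>\<^sup>2}) (at_right 0)"
    using eventually_at_right[of 0 "1::real"] \<rho> by (auto intro!: exI[of _ "Min {1, \<rho>, \<rho>\<^sup>2}"])
  ultimately have "\<exists>t. log_moment W t < ereal (- 2 * C) \<and> 0 < t \<and> t < Min {1, \<rho>, \<rho>\<^sup>2}"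
    using eventually_happens'[OF trivial_limit_at_right_real eventually_conj] by blast
  then obtain t where t: "log_moment W t < ereal (- 2 * C)" "0 < t" "t < 1" "t < \<rho>" "t < \<rho>\<^sup>2"
    by auto
  have l: "ln (\<rho> / t) > 0" using t by simp
  have "ln t \<le> ln (\<rho>\<^sup>2)" using t by (intro ln_mono) auto
  then have l2: "- ln t \<le> 2 * ln (\<rho> / t)"
    using t \<rho> by (simp add: ln_div ln_realpow)
  have le: "(\<integral>\<^sup>+s\<in>{0<..<t}. ennreal (s * W s) \<partial>lebesgue) \<le> ennreal (C / ln (\<rho> / t))"
    using t by (intro moment)
  show False
  proof (cases "\<integral>\<^sup>+s\<in>{0<..<t}. ennreal (s * W s) \<partial>lebesgue" rule: ennreal_cases)
    case (real x)
    have x: "x \<le> C / ln (\<rho> / t)"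
      using le real C l by simp
    have "(- ln t) * x \<le> (2 * ln (\<rho> / t)) * (C / ln (\<rho> / t))"
      using x l2 l real by (intro mult_mono) auto
    also have "\<dots> = 2 * C" using l by simp
    finally show False
      using t(1) real by (simp add: log_moment_def enn2ereal_ennreal)
  next
    case top
    then show False using le by (simp add: top_unique)
  qed
qed

end
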